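(* Let $\mathbb K$ be a field and let $c,d,t\in\mathbb K$ with $2t=0$ be such that the restriction of the Pfaffian form $\mathrm{pf}$ to the space $W=W^t_{c,d}$ is anisotropic. With $\mathbb H$, $\mathbb H^\rho$ and $W$ as defined in the context, the stabilizer $\Sigma_W$ of $W$ in $\mathrm{GL}_4(\mathbb K)$ is $\Sigma_W=\mathbb H^\times\,\mathbb H^\rho$.
   Context: $X'$ denotes the transpose of a matrix $X$; $b_0,\dots,b_3$ is the standard basis of $\mathbb K^4$. $\Lambda=\mathbb K^4\wedge\mathbb K^4$ is the space of skew-symmetric $4\times4$ matrices over $\mathbb K$ with zero diagonal, $s_{jk}:=b_jb_k'-b_kb_j'$. $\mathrm{GL}_4(\mathbb K)$ acts on $\Lambda$ by $M.X:=MXM'$. The Pfaffian form is $\mathrm{pf}\bigl(\sum_{j<k}x_{jk}s_{jk}\bigr)=x_{01}x_{23}-x_{02}x_{13}+x_{03}x_{12}$. Let $i:=\begin{pmatrix} 0 & 1 \\ -1 & 0 \end{pmatrix}$, $\xi:=\begin{pmatrix} 1 & t \\ 0 & -1 \end{pmatrix}$ and $\mathbb L:=\left\{\begin{pmatrix} x & -yd \\ y & x+yt \end{pmatrix}\ \middle|\ x,y\in\mathbb K\right\}\subseteq\mathbb K^{2\times2}$; put $\overline A:=\xi A\xi^{-1}$ for $A\in\mathbb L$. Define $$W:=W^t_{c,d}:=\langle s_{03}-s_{12},\,cs_{01}-s_{23},\,s_{13}+ds_{02}+ts_{03}\rangle=\left\{\begin{pmatrix} xci & Yi \\ \overline Yi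 & -xi \end{pmatrix}\ \middle|\ x\in\mathbb K,\ Y\in\mathbb L\right\}.$$ Since $\mathrm{pf}|_W$ is anisotropic, $X^2+tX+d$ is irreducible and $\mathbb L$ is a field isomorphic to $\mathbb K[X]/(X^2+tX+d)$. Put (as sets of $2\times2$ block matrices in $\mathbb K^{4\times4}$) $$\mathbb H:=\left\{\begin{pmatrix} A & -c\overline B \\ B & \overline A \end{pmatrix}\ \middle|\ A,B\in\mathbb L\right\},\qquad \mathbb H^\rho:=\left\{\begin{pmatrix} A & -cB\xi \\ B\xi & A \end{pmatrix}\ \middle|\ (A,B)\in\mathbb L^2\setminus\{(0,0)\}\right\}.$$ $\mathbb H$ is a quaternion field if $\mathbb L/\mathbb K$ is separable, and a commutative field (with $\mathbb H^\rho=\mathbb H^\times$) if $\mathbb L/\mathbb K$ is inseparable; $\mathbb H^\rho$ is the centralizer of $\mathbb H^\times=\mathbb H\setminus\{0\}$ in $\mathrm{GL}_4(\mathbb K)$. *)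

theory Defs
  imports "HOL-Analysis.Analysis"
begin

text \<open>
  Rows and columns of \<open>4 \<times> 4\<close> matrices are indexed by \<open>0, 1, 2, 3 :: 4\<close>; those of
  \<open>2 \<times> 2\<close> matrices by \<open>1, 2 :: 2\<close>, in this order, which is the convention
  of \<^const>\<open>vector\<close>.
\<close>

definition mscale :: "'a::field \<Rightarrow> 'a^4^4 \<Rightarrow> 'a^4^4" where
  "mscale k X = (\<chi> i j. k * X $ i $ j)"

interpretation mat4: vector_space "mscale :: 'a::field \<Rightarrow> 'a^4^4 \<Rightarrow> 'a^4^4"
  by unfold_locales (simp_all add: mscale_def vec_eq_iff algebra_simps)

definition GL4 :: "('a::field^4^4) set" where
  "GL4 = {M. invertible M}"

definition act :: "'a::field^4^4 \<Rightarrow> 'a^4^4 \<Rightarrow> 'a^4^4" where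
  "act M X = M ** X ** transpose M"

definition stabilizer :: "('a::field^4^4) set \<Rightarrow> ('a^4^4) set" where
  "stabilizer U = {M \<in> GL4. act M ` U = U}"

definition skew :: "4 \<Rightarrow> 4 \<Rightarrow> 'a::field^4^4" where
  "skew j k = (\<chi> p q. axis j 1 $ p * axis k 1 $ q - axis k 1 $ p * axis j 1 $ q)"

definition Lam :: "('a::field^4^4) set" where
  "Lam = {X. transpose X = - X \<and> (\<forall>i. X $ i $ i = 0)}"

text \<open>For \<open>j < k\<close>, the coefficient of \<open>skew j k\<close> in an element \<open>X\<close> of \<open>Lam\<close> is
  the entry \<open>X $ j $ k\<close>. Outside \<open>Lam\<close> the values of \<open>pf\<close> are irrelevant.\<close>

definition pf :: "'a::field^4^4 \<Rightarrow> 'a" where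
  "pf X = X $ 0 $ 1 * X $ 2 $ 3 - X $ 0 $ 2 * X $ 1 $ 3 + X $ 0 $ 3 * X $ 1 $ 2"

definition anisotropic_on :: "('a::field^4^4 \<Rightarrow> 'a) \<Rightarrow> ('a^4^4) set \<Rightarrow> bool" where
  "anisotropic_on q U \<longleftrightarrow> (\<forall>X\<in>U. q X = 0 \<longrightarrow> X = 0)"

definition W :: "'a::field \<Rightarrow> 'a \<Rightarrow> 'a \<Rightarrow> ('a^4^4) set" where
  "W t c d = mat4.span {skew 0 3 - skew 1 2, mscale c (skew 0 1) - skew 2 3,
                        skew 1 3 + mscale d (skew 0 2) + mscale t (skew 0 3)}"

definition mat2 :: "'a::field \<Rightarrow> 'a \<Rightarrow> 'a \<Rightarrow> 'a \<Rightarrow> 'a^2^2" where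
  "mat2 a b c d = vector [vector [a, b], vector [c, d]]"

definition smult2 :: "'a::field \<Rightarrow> 'a^2^2 \<Rightarrow> 'a^2^2" where
  "smult2 k A = (\<chi> i j. k * A $ i $ j)"

definition block :: "'a::field^2^2 \<Rightarrow> 'a^2^2 \<Rightarrow> 'a^2^2 \<Rightarrow> 'a^2^2 \<Rightarrow> 'a^4^4" where
  "block P Q R S =
     (let low = (\<lambda>i::4. i = 0 \<or> i = 1);
          pos = (\<lambda>i::4. if i = 0 \<or> i = 2 then 1 else 2 :: 2)
      in \<chi> i j. (if low i then (if low j then P else Q) else (if low j then R else S))
                 $ pos i $ pos j)"

definition imat :: "'a::field^2^2" where
  "imat = mat2 0 1 (- 1) 0"

definition xi :: "'a::field \<Rightarrow> 'a^2^2" where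
  "xi t = mat2 1 t 0 (- 1)"

definition L :: "'a::field \<Rightarrow> 'a \<Rightarrow> ('a^2^2) set" where
  "L t d = {mat2 x (- y * d) y (x + y * t) | x y. True}"

definition conjL :: "'a::field \<Rightarrow> 'a^2^2 \<Rightarrow> 'a^2^2" where
  "conjL t A = xi t ** A ** matrix_inv (xi t)"

definition H :: "'a::field \<Rightarrow> 'a \<Rightarrow> 'a \<Rightarrow> ('a^4^4) set" where
  "H t c d = {block A (smult2 (- c) (conjL t B)) B (conjL t A) | A B. A \<in> L t d \<and> B \<in> L t d}"

definition H_units :: "'a::field \<Rightarrow> 'a \<Rightarrow> 'a \<Rightarrow> ('a^4^4) set" where
  "H_units t c d = H t c d - {0}"

definition H_rho :: "'a::field \<Rightarrow> 'a \<Rightarrow> 'a \<Rightarrow> ('a^4^4) set" where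
  "H_rho t c d = {block A (smult2 (- c) (B ** xi t)) (B ** xi t) A | A B.
                    A \<in> L t d \<and> B \<in> L t d \<and> (A, B) \<noteq> (0, 0)}"

lemma exhaust4: "i = 0 \<or> i = 1 \<or> i = 2 \<or> i = (3::4)"
  using exhaust_4[of i] by auto

lemma forall4: "(\<forall>i::4. P i) \<longleftrightarrow> P 0 \<and> P 1 \<and> P 2 \<and> P 3"
  by (metis exhaust4)

lemma xi_inv: "matrix_inv (xi t) = (xi t :: 'a::field^2^2)"
proof -
  have x: "xi t ** xi t = (mat 1 :: 'a^2^2)"
    by (simp add: xi_def mat2_def matrix_matrix_mult_def vec_eq_iff forall_2 sum_2 mat_def)
  then have "invertible (xi t)" unfolding invertible_def by blast
  then have "matrix_inv (xi t) ** xi t = mat 1" unfolding matrix_inv_def invertible_def by (rule someI2_ex) blast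
  then have "(matrix_inv (xi t) ** xi t) ** xi t = xi t" by simp
  then show ?thesis unfolding matrix_mul_assoc[symmetric] x by simp
qed

lemma W_eq_block:
  assumes "2 * t = (0::'a::field)"
  shows "W t c d = {block (smult2 (x * c) imat) (Y ** imat) (conjL t Y ** imat) (smult2 (- x) imat)
                     | x Y. Y \<in> L t d}" (is "_ = ?R")
proof -
  have t: "t + t = 0" using assms by (simp only: mult_2)
  define F where "F a b e = mscale a (skew 0 3 - skew 1 2) + mscale b (mscale c (skew 0 1) - skew 2 3)
        + mscale e (skew 1 3 + mscale d (skew 0 2) + mscale t (skew 0 3))" for a b e
  have tx: "x * t + x * t = 0" for x
    by (simp only: distrib_left[symmetric] t mult_zero_right)
  have E: "F a b e = block (smult2 (b * c) imat) (mat2 (a + e * t) (- e * d) e (a + e * t + e * t) ** imat)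
          (conjL t (mat2 (a + e * t) (- e * d) e (a + e * t + e * t)) ** imat) (smult2 (- b) imat)" for a b e
  proof -
    define m where "m = e * t"
    have em: "e * t = m" "t * e = m" by (simp_all add: m_def mult.commute)
    have m: "m + m = 0" unfolding m_def by (rule tx)
    have n: "- m = m" by (rule minus_unique[OF m])
    have Y: "mat2 (a + e * t) (- e * d) e (a + e * t + e * t) = mat2 (a + m) (- e * d) e a"
      by (simp only: m_def[symmetric] add.assoc m add_0_right)
    show ?thesis unfolding Y conjL_def xi_inv F_def
      by (simp add: vec_eq_iff forall4 mscale_def skew_def axis_def block_def Let_def smult2_def
          imat_def mat2_def xi_def matrix_matrix_mult_def sum_2 em m n add.assoc mult.commute)
  qed
  have "W t c d = {F a b e | a b e. True}"
    unfolding W_def mat4.span_insert mat4.span_empty F_def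
    by (auto simp: algebra_simps)
  also have "\<dots> = ?R"
  proof (intro equalityI subsetI)
    fix X assume "X \<in> {F a b e | a b e. True}"
    then show "X \<in> ?R" unfolding E L_def by blast
  next
    fix X assume "X \<in> ?R"
    then obtain x u v where "X = block (smult2 (x * c) imat) (mat2 u (- v * d) v (u + v * t) ** imat)
        (conjL t (mat2 u (- v * d) v (u + v * t)) ** imat) (smult2 (- x) imat)"
      unfolding L_def by blast
    then have "X = F (u - v * t) x v" unfolding E by simp
    then show "X \<in> {F a b e | a b e. True}" by blast
  qed
  finally show ?thesis .
qed

lemma W_subset: "W t c d \<subseteq> (Lam :: ('a::field^4^4) set)"
proof -
  have sub: "mat4.subspace (Lam :: ('a^4^4) set)"
  proof -
    have "transpose (X + Y) = transpose X + transpose Y" for X Y :: "'a^4^4"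
      by (simp add: vec_eq_iff transpose_def)
    moreover have "transpose (mscale k X) = mscale k (transpose X)" for k and X :: "'a^4^4"
      by (simp add: vec_eq_iff transpose_def mscale_def)
    moreover have "mscale k X $ i $ i = k * X $ i $ i" for k i and X :: "'a^4^4"
      by (simp add: mscale_def)
    moreover have "transpose (0 :: 'a^4^4) = 0"
      by (simp add: vec_eq_iff transpose_def)
    ultimately show ?thesis
      by (simp add: mat4.subspace_def Lam_def)
  qed
  have skew: "skew j k \<in> Lam" for j k
    by (simp add: Lam_def skew_def transpose_def vec_eq_iff)
  show ?thesis unfolding W_def
    by (rule mat4.span_minimal[OF _ sub])
      (simp add: skew mat4.subspace_add mat4.subspace_diff mat4.subspace_scale sub)
qed

end

theory Submission
  imports Defs
begin

text \<open>
  Write \<open>W = V X\<^sub>0\<close> with \<open>V = K + L j \<subseteq> H\<close> and \<open>X\<^sub>0 = c s\<^sub>0\<^sub>1 - s\<^sub>2\<^sub>3\<close>. If \<open>M\<close> stabilizes \<open>W\<close> and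
  \<open>M X\<^sub>0 M' = v\<^sub>0 X\<^sub>0\<close>, then for \<open>v \<in> V\<close> both \<open>M v X\<^sub>0 M' = (M v M\<inverse>) v\<^sub>0 X\<^sub>0\<close> and \<open>v\<^sub>0 X\<^sub>0\<close> lie
  in \<open>W\<close>, so \<open>M v M\<inverse> \<in> H\<close>, because \<open>H\<close> is a division algebra. As \<open>V\<close> generates \<open>H\<close>, conjugation
  by \<open>M\<close> is an automorphism of \<open>H\<close>; it is inner by Skolem--Noether, or trivial if \<open>H\<close> is a purely
  inseparable field. Hence \<open>M\<close> lies in \<open>H\<^sup>\<times>\<close> times the centralizer of \<open>H\<close>, which is \<open>H\<^sup>\<rho>\<close>.
  Conversely \<open>H\<^sup>\<rho>\<close> acts on \<open>W\<close> by scalars, and \<open>h v X\<^sub>0 h' = h v h\<^sup>* X\<^sub>0\<close> for an involution of \<open>H\<close>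
  for which \<open>h v h\<^sup>* \<in> V\<close>.
\<close>

section \<open>Matrix algebra and coordinates\<close>

lemma sum_UNIV_4: "(\<Sum>i\<in>UNIV. f i) = f 0 + f 1 + f 2 + f (3::4)"
  for f :: "4 \<Rightarrow> 'b::comm_monoid_add"
proof -
  \<comment> \<open>The library sum runs over 1, 2, 3, 4; in this cyclic index type the last index
    is 0.\<close>
  have "(4::4) = 0" by simp
  then show ?thesis using sum_4[of f] by (simp only: ac_simps)
qed

definition lmat :: "'a::field \<Rightarrow> 'a \<Rightarrow> 'a \<Rightarrow> 'a \<Rightarrow> 'a^2^2" where
  "lmat t d x y = mat2 x (- y * d) y (x + y * t)"

text \<open>With \<open>l = lmat t d 0 1\<close>, \<open>quat t c d x y z w\<close> is the element \<open>(x + y l) + j (z + w l)\<close> of \<open>H\<close>,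
  where \<open>j\<^sup>2 = - c\<close> and \<open>j A = conj(A) j\<close> for \<open>A\<close> in \<open>L\<close>.\<close>

definition quat :: "'a::field \<Rightarrow> 'a \<Rightarrow> 'a \<Rightarrow> 'a \<Rightarrow> 'a \<Rightarrow> 'a \<Rightarrow> 'a \<Rightarrow> 'a^4^4" where
  "quat t c d x y z w = block (lmat t d x y) (smult2 (- c) (lmat t d (z + w * t) (- w)))
                          (lmat t d z w) (lmat t d (x + y * t) (- y))"

definition quat_rho :: "'a::field \<Rightarrow> 'a \<Rightarrow> 'a \<Rightarrow> 'a \<Rightarrow> 'a \<Rightarrow> 'a \<Rightarrow> 'a \<Rightarrow> 'a^4^4" where
  "quat_rho t c d x y z w = block (lmat t d x y) (smult2 (- c) (lmat t d z w ** xi t))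
                              (lmat t d z w ** xi t) (lmat t d x y)"

definition wmat :: "'a::field \<Rightarrow> 'a \<Rightarrow> 'a \<Rightarrow> 'a \<Rightarrow> 'a \<Rightarrow> 'a \<Rightarrow> 'a^4^4" where
  "wmat t c d r x y = block (smult2 (r * c) imat) (lmat t d x y ** imat)
                        (lmat t d (x + y * t) (- y) ** imat) (smult2 (- r) imat)"

lemmas matrix_entry_simps = vec_eq_iff forall4 block_def Let_def smult2_def
  lmat_def imat_def mat2_def xi_def matrix_matrix_mult_def sum_2 sum_UNIV_4

lemmas quat_simps = quat_def quat_rho_def wmat_def matrix_entry_simps mscale_def mat_def transpose_def

lemma mscale_mult_left: "mscale k A ** B = mscale k (A ** B)"
  by (simp add: mscale_def matrix_matrix_mult_def vec_eq_iff sum_distrib_left mult.assoc)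

lemma mscale_mult_right: "A ** mscale k B = mscale k (A ** B)"
  by (simp add: mscale_def matrix_matrix_mult_def vec_eq_iff sum_distrib_left mult.left_commute)

lemma matrix_diff_distrib:
  fixes A :: "'a::field^4^4"
  shows "A ** (B - C) = A ** B - A ** C" "(B - C) ** A = B ** A - C ** A"
  by (simp_all add: matrix_matrix_mult_def vec_eq_iff sum_subtractf algebra_simps)

lemma matrix_add_rdistrib: "(B + C) ** A = B ** A + C ** A" for A :: "'a::field^4^4"
  by (simp add: matrix_matrix_mult_def vec_eq_iff sum.distrib algebra_simps)

lemma matrix_zero: "A ** 0 = (0 :: 'a::field^4^4)" "0 ** A = (0 :: 'a::field^4^4)" for A :: "'a::field^4^4"
  by (simp_all add: matrix_matrix_mult_def vec_eq_iff)

lemma mat_1_neq_0: "mat 1 \<noteq> (0 :: 'a::field^4^4)"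
  by (simp add: mat_def vec_eq_iff)

lemma cancel_left: "A ** B = mat 1 \<Longrightarrow> A ** (B ** C) = C" for A B C :: "'a::field^4^4"
  by (simp add: matrix_mul_assoc)

lemma cancel_right: "A ** M = B ** M \<Longrightarrow> M ** M' = mat 1 \<Longrightarrow> A = B" for A B M M' :: "'a::field^4^4"
  by (metis matrix_mul_assoc matrix_mul_rid)

lemma matrix_minus: "A ** (- B) = - (A ** B)" "(- B) ** A = - (B ** A)" for A B :: "'a::field^4^4"
  by (simp_all add: matrix_matrix_mult_def vec_eq_iff sum_negf)

lemmas matrix_ring_simps = matrix_add_ldistrib matrix_add_rdistrib matrix_diff_distrib matrix_minus
  matrix_zero mscale_mult_left mscale_mult_right

text \<open>Closure of \<open>U\<close> under the inverse \<open>N\<close> makes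
  \<open>act M\<close> surjective on \<open>U\<close>.\<close>

lemma stabilizer_I:
  assumes "M ** N = mat 1" "N ** M = mat 1"
    and "\<And>X. X \<in> U \<Longrightarrow> act M X \<in> U" "\<And>X. X \<in> U \<Longrightarrow> act N X \<in> U"
  shows "(M :: 'a::field^4^4) \<in> stabilizer U"
proof -
  have "transpose N ** transpose M = mat 1"
    using assms by (simp flip: matrix_transpose_mul)
  then have "act M (act N X) = X" for X
    using assms(1) by (simp add: act_def cancel_left flip: matrix_mul_assoc)
  then have "act M ` U = U" using assms(3,4) by (metis image_eqI subsetI subset_antisym image_subsetI)
  then show ?thesis using assms(1,2) unfolding stabilizer_def GL4_def invertible_def by blast
qed

lemma stabilizer_mult:
  assumes "M \<in> stabilizer U" "N \<in> stabilizer U"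
  shows "M ** N \<in> stabilizer U"
proof -
  have "act (M ** N) X = act M (act N X)" for X
    by (simp add: act_def matrix_transpose_mul matrix_mul_assoc)
  then have "act (M ** N) ` U = act M ` (act N ` U)" by (simp add: image_image)
  then show ?thesis using assms by (simp add: stabilizer_def GL4_def invertible_mult)
qed

section \<open>Coordinates for \<open>H\<close>, \<open>H_rho\<close> and \<open>W\<close>\<close>

locale anisotropic_W =
  fixes c d t :: "'a::field"
  assumes two_t: "2 * t = 0"
    and aniso: "anisotropic_on pf (W t c d)"
begin

lemma conjL_lmat: "conjL t (lmat t d x y) = lmat t d (x + y * t) (- y)"
  unfolding conjL_def xi_inv
  by (simp add: lmat_def mat2_def xi_def matrix_matrix_mult_def vec_eq_iff forall_2 sum_2)

lemma L_eq: "L t d = {lmat t d x y | x y. True}"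
  by (simp add: L_def lmat_def)

lemma H_eq: "H t c d = {quat t c d x y z w | x y z w. True}"
  unfolding H_def L_eq quat_def using conjL_lmat
  by (smt (verit, best) Collect_cong mem_Collect_eq)

lemma W_eq: "W t c d = {wmat t c d r x y | r x y. True}"
  unfolding W_eq_block[OF two_t] L_eq wmat_def using conjL_lmat
  by (smt (verit, best) Collect_cong mem_Collect_eq)

lemma lmat_eq_0_iff: "lmat t d x y = 0 \<longleftrightarrow> x = 0 \<and> y = 0"
  by (auto simp: lmat_def mat2_def vec_eq_iff forall_2)

lemma H_rho_eq: "H_rho t c d = {quat_rho t c d x y z w | x y z w. (x, y, z, w) \<noteq> (0, 0, 0, 0)}"
proof -
  have nz: "(lmat t d x y, lmat t d z w) \<noteq> (0, 0) \<longleftrightarrow> (x, y, z, w) \<noteq> (0, 0, 0, 0)" for x y z w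
    by (simp only: prod.inject lmat_eq_0_iff conj_assoc)
  show ?thesis
  proof (intro equalityI subsetI)
    fix M assume "M \<in> H_rho t c d"
    then obtain x y z w where "M = quat_rho t c d x y z w"
      and "(lmat t d x y, lmat t d z w) \<noteq> (0, 0)"
      unfolding H_rho_def L_eq quat_rho_def by blast
    then show "M \<in> {quat_rho t c d x y z w | x y z w. (x, y, z, w) \<noteq> (0, 0, 0, 0)}"
      using nz by blast
  next
    fix M assume "M \<in> {quat_rho t c d x y z w | x y z w. (x, y, z, w) \<noteq> (0, 0, 0, 0)}"
    then obtain x y z w where "M = quat_rho t c d x y z w" "(x, y, z, w) \<noteq> (0, 0, 0, 0)"
      by blast
    then show "M \<in> H_rho t c d"
      unfolding H_rho_def L_eq quat_rho_def using nz by blast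
  qed
qed

lemma quat_mult:
  "quat t c d x y z w ** quat t c d x' y' z' w' =
   quat t c d (x * x' - d * y * y' - c * ((z + w * t) * z' + d * w * w'))
              (x * y' + y * x' + t * y * y' - c * ((z + w * t) * w' - w * z' - t * w * w'))
              (z * x' - d * w * y' + (x + y * t) * z' + d * y * w')
              (z * y' + w * x' + t * w * y' + (x + y * t) * w' - y * z' - t * y * w')"
  by (simp add: quat_simps algebra_simps)

lemma pf_wmat: "pf (wmat t c d r x y) = - (x * x + t * x * y + d * y * y + c * r * r)"
  by (simp add: quat_simps pf_def algebra_simps)

lemma H_mult: "M \<in> H t c d \<Longrightarrow> N \<in> H t c d \<Longrightarrow> M ** N \<in> H t c d"
  unfolding H_eq mem_Collect_eq using quat_mult by metis

lemma quat_add: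
  "quat t c d x y z w + quat t c d x' y' z' w' = quat t c d (x + x') (y + y') (z + z') (w + w')"
  by (simp add: quat_simps algebra_simps)

lemma mscale_quat:
  "mscale k (quat t c d x y z w) = quat t c d (k * x) (k * y) (k * z) (k * w)"
  by (simp add: quat_simps algebra_simps)

lemma H_add: "M \<in> H t c d \<Longrightarrow> N \<in> H t c d \<Longrightarrow> M + N \<in> H t c d"
  unfolding H_eq mem_Collect_eq using quat_add by metis

lemma H_mscale: "M \<in> H t c d \<Longrightarrow> mscale k M \<in> H t c d"
  unfolding H_eq mem_Collect_eq using mscale_quat by metis

section \<open>The norm form N(A) + c N(B) of A + jB, with N the norm of \<open>L\<close> over
  K\<close>

definition nrm where
  "nrm x y z w = x * x + t * x * y + d * y * y + c * (z * z + t * z * w + d * w * w)"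

lemma quat_mult_conj:
  "quat t c d x y z w ** quat t c d (x + y * t) (- y) (- z) (- w) = mscale (nrm x y z w) (mat 1)"
  by (simp add: quat_simps nrm_def algebra_simps)

lemma quat_conj_mult:
  "quat t c d (x + y * t) (- y) (- z) (- w) ** quat t c d x y z w = mscale (nrm x y z w) (mat 1)"
  by (simp add: quat_simps nrm_def algebra_simps)

lemma quat_rho_mult_conj:
  "quat_rho t c d x y z w ** quat_rho t c d (x + y * t) (- y) (- z) (- w) =
    mscale (nrm x y z w) (mat 1)"
  by (simp add: quat_simps nrm_def algebra_simps)

lemma quat_rho_conj_mult:
  "quat_rho t c d (x + y * t) (- y) (- z) (- w) ** quat_rho t c d x y z w =
    mscale (nrm x y z w) (mat 1)"
  by (simp add: quat_simps nrm_def algebra_simps)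

text \<open>The anisotropy hypothesis in coordinates: up to sign, the Pfaffian on \<open>W\<close>
  is N(x + y l) + c r^2.\<close>

lemma wmat_aniso:
  assumes "x * x + t * x * y + d * y * y + c * r * r = 0"
  shows "r = 0 \<and> x = 0 \<and> y = 0"
proof -
  have "pf (wmat t c d r x y) = 0" using assms by (simp add: pf_wmat)
  then have "wmat t c d r x y = 0" using aniso unfolding anisotropic_on_def W_eq by blast
  then show ?thesis by (auto simp: quat_simps)
qed

lemma c_nonzero: "c \<noteq> 0"
  using wmat_aniso[of 0 0 1] by auto

text \<open>If the norm of \<open>A + jB\<close> vanished with \<open>B \<noteq> 0\<close>, multiplying by the norm of \<open>B\<close> would
  produce a zero of the anisotropic form with \<open>r = N(B)\<close>.\<close>

lemma nrm_eq_0: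
  assumes "nrm x y z w = 0"
  shows "x = 0 \<and> y = 0 \<and> z = 0 \<and> w = 0"
proof -
  define r where "r = z * z + t * z * w + d * w * w"
  \<comment> \<open>\<open>a\<close> and \<open>b\<close> are the coordinates of A conj(B), whose
    norm is N(A) N(B).\<close>
  define a where "a = x * z + d * y * w + t * x * w"
  define b where "b = y * z - x * w"
  have "a * a + t * a * b + d * b * b = (x * x + t * x * y + d * y * y) * r"
    unfolding a_def b_def r_def by (simp add: algebra_simps)
  also have "\<dots> = - (c * r * r)"
  proof -
    have "x * x + t * x * y + d * y * y = - (c * r)"
      using assms unfolding nrm_def r_def by (simp only: eq_neg_iff_add_eq_0)
    then show ?thesis by (simp only: minus_mult_left)
  qed
  finally have "r = 0" using wmat_aniso[of a b r] by simp
  then have "z = 0 \<and> w = 0" using wmat_aniso[of z w 0] by (simp add: r_def)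
  then show ?thesis using assms wmat_aniso[of x y 0] by (simp add: nrm_def)
qed

section \<open>The factorization W = V X0\<close>

definition X0 where "X0 = wmat t c d 1 0 0"

text \<open>The vanishing second coordinate of \<open>quat\<close> cuts out V = K + L j in
  \<open>H\<close>.\<close>

lemma wmat_eq_quat: "wmat t c d r (c * (z + w * t)) (- (c * w)) = quat t c d r 0 z w ** X0"
  unfolding X0_def
  by (simp add: quat_simps algebra_simps)

text \<open>Moving a transpose across \<open>X0\<close> turns it into the involution A + jB ->
  conj(A) + jB of \<open>H\<close>, which fixes V pointwise.\<close>

lemma X0_quat: "X0 ** transpose (quat t c d x y z w) = quat t c d (x + y * t) (- y) z w ** X0"
  unfolding X0_def
  by (simp add: quat_simps algebra_simps)

lemma quat_rho_X0: "act (quat_rho t c d x y z w) X0 = mscale (nrm x y z w) X0"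
  unfolding X0_def act_def nrm_def
  by (simp add: quat_simps algebra_simps)

lemma quat_rho_commute:
  "quat_rho t c d x y z w ** quat t c d x' y' z' w' = quat t c d x' y' z' w' ** quat_rho t c d x y z w"
  by (simp add: quat_simps algebra_simps)

lemma one_eq_quat: "mat 1 = quat t c d 1 0 0 0"
  by (simp add: quat_simps)

lemma quat_eq_0_iff: "quat t c d x y z w = 0 \<longleftrightarrow> x = 0 \<and> y = 0 \<and> z = 0 \<and> w = 0"
  by (auto simp: quat_simps)

lemma H_inverse:
  assumes "M \<in> H t c d" "M \<noteq> 0"
  obtains N where "N \<in> H t c d" "M ** N = mat 1" "N ** M = mat 1"
proof -
  obtain x y z w where M: "M = quat t c d x y z w" using assms(1) unfolding H_eq by blast
  define C where "C = quat t c d (x + y * t) (- y) (- z) (- w)"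
  define n where "n = nrm x y z w"
  have n: "n \<noteq> 0" using nrm_eq_0 assms(2) unfolding n_def M quat_eq_0_iff by blast
  have C: "C \<in> H t c d" unfolding C_def H_eq by blast
  have "M ** C = mscale n (mat 1)" "C ** M = mscale n (mat 1)"
    unfolding M C_def n_def by (rule quat_mult_conj quat_conj_mult)+
  then show thesis
    using that[OF H_mscale[OF C, of "inverse n"]] n
    by (simp add: mscale_mult_left mscale_mult_right mat4.scale_scale)
qed

section \<open>Generators of \<open>H\<close> and their centralizer\<close>

definition lq where "lq = quat t c d 0 1 0 0"
definition jq where "jq = quat t c d 0 0 1 0"
definition lbar where "lbar = mscale t (mat 1) - lq"

lemma lbar_eq: "lbar = quat t c d t (- 1) 0 0"
  unfolding lbar_def lq_def by (simp add: quat_simps)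

lemma lq_lq: "lq ** lq = mscale t lq - mscale d (mat 1)"
  unfolding lq_def quat_mult one_eq_quat mscale_quat by (simp add: quat_simps)

lemma jq_jq: "jq ** jq = mscale (- c) (mat 1)"
  unfolding jq_def quat_mult one_eq_quat mscale_quat by simp

lemma jq_lq: "jq ** lq = lbar ** jq"
  unfolding jq_def quat_mult lbar_eq lq_def by simp

lemma lq_jq: "lq ** jq = quat t c d 0 0 t (- 1)"
  unfolding jq_def quat_mult lq_def by simp

lemma quat_in_H: "quat t c d x y z w \<in> H t c d"
  unfolding H_eq by blast

lemma quats_in_H: "lq \<in> H t c d" "jq \<in> H t c d" "lbar \<in> H t c d" "mat 1 \<in> H t c d"
  unfolding lq_def jq_def lbar_eq one_eq_quat by (rule quat_in_H)+

text \<open>The first basis vector generates K^4 over \<open>H\<close>, so a matrix commuting with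
  the generators of \<open>H\<close> is determined by its first column.\<close>

lemma centralizer:
  assumes "M ** lq = lq ** M" "M ** jq = jq ** M"
  shows "M = quat_rho t c d (M $ 0 $ 0) (M $ 1 $ 0) (M $ 2 $ 0) (M $ 3 $ 0)"
  using assms unfolding lq_def jq_def by (auto simp: quat_simps)

section \<open>The action on \<open>W\<close>\<close>

lemma W_eq_image: "W t c d = {quat t c d r 0 z w ** X0 | r z w. True}"
proof -
  \<comment> \<open>The arguments solve x = c (z + w t), y = - c w for z and w.\<close>
  have "wmat t c d r x y = quat t c d r 0 (x / c + y / c * t) (- (y / c)) ** X0" for r x y
    using wmat_eq_quat[of r "x / c + y / c * t" "- (y / c)"] c_nonzero
    by (simp add: distrib_left)
  then show ?thesis unfolding W_eq wmat_eq_quat[symmetric] set_eq_iff mem_Collect_eq by metis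
qed

lemma X0_inverse:
  obtains Z where "X0 ** Z = mat 1" "Z ** X0 = mat 1"
proof -
  define Z where "Z = block (smult2 (- inverse c) imat) 0 0 imat"
  have "X0 ** Z = mat 1" "Z ** X0 = mat 1"
    using c_nonzero unfolding Z_def X0_def by (simp_all add: quat_simps)
  then show thesis by (rule that)
qed

lemma X0_in_W: "X0 \<in> W t c d"
  unfolding X0_def W_eq by blast

lemma H_act:
  assumes "M \<in> H t c d" "X \<in> W t c d"
  shows "act M X \<in> W t c d"
proof -
  obtain x y z w where M: "M = quat t c d x y z w" using assms(1) unfolding H_eq by blast
  obtain r a b where X: "X = quat t c d r 0 a b ** X0" using assms(2) unfolding W_eq_image by blast
  have act: "act M X = (M ** quat t c d r 0 a b ** quat t c d (x + y * t) (- y) z w) ** X0"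
    unfolding act_def X M by (simp only: matrix_mul_assoc[symmetric] X0_quat)
  have "\<exists>r' z' w'. M ** quat t c d r 0 a b ** quat t c d (x + y * t) (- y) z w = quat t c d r' 0 z' w'"
  proof -
    define x1 y1 z1 w1 where "x1 = x * r - c * ((z + w * t) * a + d * w * b)"
      and "y1 = y * r - c * ((z + w * t) * b - w * a - t * w * b)"
      and "z1 = z * r + (x + y * t) * a + d * y * b"
      and "w1 = w * r + (x + y * t) * b - y * a - t * y * b"
    have prod: "M ** quat t c d r 0 a b = quat t c d x1 y1 z1 w1"
      unfolding M quat_mult x1_def y1_def z1_def w1_def by simp
    \<comment> \<open>This is the second coordinate of h v h*. It is computed directly because being
      fixed by the involution does not characterize V when L/K is inseparable.\<close>
    have "x1 * (- y) + y1 * (x + y * t) + t * y1 * (- y)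
        - c * ((z1 + w1 * t) * w - w1 * z - t * w1 * w) = 0"
      unfolding x1_def y1_def z1_def w1_def by (simp add: algebra_simps)
    then show ?thesis unfolding prod quat_mult by metis
  qed
  then obtain r' z' w' where
    "M ** quat t c d r 0 a b ** quat t c d (x + y * t) (- y) z w = quat t c d r' 0 z' w'" by blast
  then show ?thesis unfolding act W_eq_image by auto
qed

text \<open>\<open>N\<close> commutes with the left factor from \<open>H\<close>, so it scales all
  of \<open>W\<close> as it scales \<open>X0\<close>.\<close>

lemma H_rho_act:
  assumes "N = quat_rho t c d x y z w" "X \<in> W t c d"
  shows "act N X = mscale (nrm x y z w) X"
proof -
  obtain r a b where X: "X = quat t c d r 0 a b ** X0" using assms(2) unfolding W_eq_image by blast
  have "act N X = quat t c d r 0 a b ** act N X0"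
    unfolding act_def X assms(1) by (simp only: matrix_mul_assoc quat_rho_commute)
  then show ?thesis unfolding assms(1) quat_rho_X0 X by (simp only: mscale_mult_right)
qed

lemma stabilizer_normalizes_H:
  assumes "M \<in> stabilizer (W t c d)"
  obtains P Q where "P \<in> H t c d" "Q \<in> H t c d" "M ** lq = P ** M" "M ** jq = Q ** M"
proof -
  obtain M' where M': "M ** M' = mat 1" "M' ** M = mat 1"
    using assms unfolding stabilizer_def GL4_def invertible_def by blast
  obtain Z where Z: "X0 ** Z = mat 1" "Z ** X0 = mat 1" by (rule X0_inverse)
  have actW: "act M X \<in> W t c d" if "X \<in> W t c d" for X
    using assms that unfolding stabilizer_def by blast
  obtain v where v: "v \<in> H t c d" "act M X0 = v ** X0"
    using actW[OF X0_in_W] unfolding W_eq_image H_eq by blast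
  have vM: "v = M ** (X0 ** transpose M ** Z)"
    using arg_cong[OF v(2), of "\<lambda>X. X ** Z"] Z
    by (simp add: act_def matrix_mul_assoc[symmetric])
  have tM: "transpose M ** transpose M' = mat 1" "transpose M' ** transpose M = mat 1"
    using M' by (simp_all flip: matrix_transpose_mul)
  have "v ** (X0 ** transpose M' ** Z ** M') = mat 1"
    unfolding vM using Z tM M' by (simp add: cancel_left flip: matrix_mul_assoc)
  then have "v \<noteq> 0" using mat_1_neq_0 by (auto simp: matrix_zero)
  then obtain n where n: "n \<in> H t c d" "n ** v = mat 1" using H_inverse[OF v(1)] by metis
  \<comment> \<open>If \<open>q ** X0\<close> is the image of \<open>u ** X0\<close>, cancelling the
    invertible factor \<open>X0 ** transpose M\<close> gives M u M^{-1} = q v^{-1}, an element of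
    \<open>H\<close>.\<close>
  have key: "\<exists>P \<in> H t c d. M ** u = P ** M" if u: "u ** X0 \<in> W t c d" for u
  proof -
    obtain q where q: "q \<in> H t c d" "act M (u ** X0) = q ** X0"
      using actW[OF u] unfolding W_eq_image H_eq by blast
    have "M ** u ** (X0 ** transpose M) = q ** (n ** v) ** X0"
      using q(2) n by (simp add: act_def matrix_mul_assoc)
    also have "\<dots> = q ** n ** M ** (X0 ** transpose M)"
      using v(2) by (simp add: act_def flip: matrix_mul_assoc)
    finally have "M ** u ** (X0 ** transpose M) ** (transpose M' ** Z) =
        q ** n ** M ** (X0 ** transpose M) ** (transpose M' ** Z)" by simp
    then have "M ** u = q ** n ** M" using tM Z
      by (simp add: cancel_left flip: matrix_mul_assoc)
    then show ?thesis using H_mult[OF q(1) n(1)] by blast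
  qed
  obtain Q where Q: "Q \<in> H t c d" "M ** jq = Q ** M"
    using key[of jq] unfolding W_eq_image jq_def by blast
  obtain R where R: "R \<in> H t c d" "M ** (lq ** jq) = R ** M"
    using key[of "lq ** jq"] unfolding W_eq_image lq_jq by blast
  \<comment> \<open>\<open>lq\<close> is not in V, but it is recovered from \<open>lq ** jq\<close>
    and \<open>jq\<close>, which are.\<close>
  have "lq = mscale (- inverse c) (lq ** jq ** jq)"
    using c_nonzero by (simp add: matrix_mul_assoc[symmetric] jq_jq matrix_ring_simps mat4.scale_scale)
  then have "M ** lq = mscale (- inverse c) (M ** (lq ** jq) ** jq)"
    by (metis mscale_mult_right matrix_mul_assoc)
  also have "\<dots> = mscale (- inverse c) (R ** Q) ** M"
    unfolding R(2) mscale_mult_left using Q(2) by (simp flip: matrix_mul_assoc)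
  finally have "M ** lq = mscale (- inverse c) (R ** Q) ** M" .
  then show thesis using that[OF H_mscale[OF H_mult[OF R(1) Q(1)]] Q(1)] Q(2) by blast
qed

section \<open>Skolem-Noether for \<open>H\<close>\<close>

lemma H_mult_nonzero:
  assumes "M \<in> H t c d" "M \<noteq> 0" "N \<noteq> 0"
  shows "M ** N \<noteq> 0"
proof
  assume "M ** N = 0"
  obtain C where "C ** M = mat 1" using H_inverse[OF assms(1,2)] by metis
  then have "N = C ** (M ** N)" by (simp add: matrix_mul_assoc)
  then show False using \<open>M ** N = 0\<close> assms(3) by (simp add: matrix_zero)
qed

lemma H_diff: "M \<in> H t c d \<Longrightarrow> N \<in> H t c d \<Longrightarrow> M - N \<in> H t c d"
  using H_add[OF _ H_mscale[of N "- 1"], of M] by simp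

text \<open>The explicit conjugators: \<open>u = P v - v l\<^sup>*\<close> intertwines \<open>l\<close> and \<open>P\<close> for every \<open>v\<close>, where \<open>l\<^sup>*\<close> is
  the conjugate of \<open>l\<close>; below, \<open>w = Q v + v j\<close> intertwines \<open>j\<close> and \<open>Q\<close>, and commutes with \<open>l\<close> if
  \<open>v\<close> lies in \<open>L j\<close>. Testing two values of \<open>v\<close> suffices for a nonzero one.\<close>

lemma conjugate_lq:
  assumes P: "P \<in> H t c d" "P ** P = mscale t P - mscale d (mat 1)" and "lbar \<noteq> lq"
  obtains u where "u \<in> H t c d" "u \<noteq> 0" "u ** lq = P ** u"
proof -
  define u where "u v = P ** v - v ** lbar" for v
  have 1: "u v ** lq = P ** u v" for v
  proof -
    have "P ** P ** v = mscale t (P ** v) - mscale d v"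
      unfolding P(2) by (simp add: matrix_diff_distrib mscale_mult_left)
    moreover have "v ** lbar ** lq = mscale d v"
      unfolding lbar_def by (simp add: matrix_ring_simps
          lq_lq flip: matrix_mul_assoc)
    moreover have "P ** v ** lbar = mscale t (P ** v) - P ** v ** lq"
      unfolding lbar_def by (simp add: matrix_ring_simps)
    ultimately show ?thesis
      unfolding u_def by (simp add: matrix_diff_distrib matrix_mul_assoc)
  qed
  have 2: "u v \<in> H t c d" if "v \<in> H t c d" for v
    unfolding u_def using that P(1) quats_in_H H_diff H_mult by simp
  \<comment> \<open>If both vanish, v = 1 gives \<open>P = lbar\<close>, and v = j then makes
    \<open>lbar\<close> commute with \<open>jq\<close>, forcing \<open>lbar = lq\<close>.\<close>
  have "u (mat 1) \<noteq> 0 \<or> u jq \<noteq> 0"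
  proof (rule ccontr)
    assume "\<not> ?thesis"
    then have "P = lbar" "lbar ** jq = jq ** lbar" by (simp_all add: u_def)
    have "jq ** lbar = lq ** jq"
      unfolding lbar_def by (simp add: matrix_ring_simps jq_lq lbar_def)
    then have "(lbar - lq) ** jq = 0" using \<open>lbar ** jq = jq ** lbar\<close>
      by (simp add: matrix_diff_distrib)
    moreover have "jq \<noteq> 0" unfolding jq_def quat_eq_0_iff by simp
    ultimately show False
      using H_mult_nonzero[OF H_diff[OF quats_in_H(3,1)], of jq] assms(3) by simp
  qed
  then show thesis using that 1 2 quats_in_H by blast
qed

lemma conjugate_jq:
  assumes Q: "Q \<in> H t c d" "Q ** Q = mscale (- c) (mat 1)" "Q ** lq = lbar ** Q" and "lbar \<noteq> lq"
  obtains w where "w \<in> H t c d" "w \<noteq> 0" "w ** jq = Q ** w" "w ** lq = lq ** w"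
proof -
  define w where "w v = Q ** v + v ** jq" for v
  have 1: "w v ** jq = Q ** w v" for v
  proof -
    have "v ** jq ** jq = mscale (- c) v" "Q ** Q ** v = mscale (- c) v"
      by (simp_all add: Q(2) jq_jq matrix_ring_simps flip: matrix_mul_assoc)
    then show ?thesis unfolding w_def
      by (simp add: matrix_add_ldistrib matrix_add_rdistrib matrix_mul_assoc)
  qed
  have jl: "jq ** lbar = lq ** jq"
    unfolding lbar_def by (simp add: matrix_ring_simps jq_lq lbar_def)
  have Ql: "Q ** lbar = lq ** Q"
    unfolding lbar_def by (simp add: matrix_ring_simps Q(3) lbar_def)
  \<comment> \<open>Both \<open>Q ** v\<close> and \<open>v ** jq\<close> conjugate
    \<open>lq\<close> twice, hence commute with it.\<close>
  have 2: "w v ** lq = lq ** w v" if v: "v ** lq = lbar ** v" "v ** lbar = lq ** v" for v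
  proof -
    have "Q ** v ** lq = lq ** (Q ** v)" using v(1) Ql by (metis matrix_mul_assoc)
    moreover have "v ** jq ** lq = lq ** (v ** jq)" using v(2) jq_lq by (metis matrix_mul_assoc)
    ultimately show ?thesis
      unfolding w_def by (simp add: matrix_add_ldistrib matrix_add_rdistrib)
  qed
  have 3: "w v \<in> H t c d" if "v \<in> H t c d" for v
    unfolding w_def using that Q(1) quats_in_H H_add H_mult by simp
  have lbar_lq: "lbar ** lq = lq ** lbar"
    unfolding lbar_def by (simp add: matrix_ring_simps)
  have 4: "(lq ** jq) ** lq = lbar ** (lq ** jq)" "(lq ** jq) ** lbar = lq ** (lq ** jq)"
    using jq_lq jl lbar_lq by (metis matrix_mul_assoc)+
  \<comment> \<open>If both vanish, v = j gives \<open>Q = - jq\<close>, and v = l j then yields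
    \<open>lbar ** jq = lq ** jq\<close>.\<close>
  have "w jq \<noteq> 0 \<or> w (lq ** jq) \<noteq> 0"
  proof (rule ccontr)
    assume "\<not> ?thesis"
    then have w: "Q ** jq + jq ** jq = 0" "Q ** (lq ** jq) + lq ** jq ** jq = 0"
      unfolding w_def by simp_all
    have "(Q + jq) ** jq = 0" using w(1) by (simp add: matrix_add_rdistrib)
    moreover have "jq \<noteq> 0" unfolding jq_def quat_eq_0_iff by simp
    ultimately have "Q + jq = 0"
      using H_mult_nonzero[OF H_add[OF Q(1) quats_in_H(2)], of jq] by blast
    have "(lbar ** Q + lq ** jq) ** jq = 0"
      using w(2) Q(3) by (simp add: matrix_add_rdistrib matrix_mul_assoc)
    then have "lbar ** Q + lq ** jq = 0"
      using H_mult_nonzero[OF H_add[OF H_mult[OF quats_in_H(3) Q(1)] H_mult[OF quats_in_H(1,2)]], of jq] \<open>jq \<noteq> 0\<close> by blast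
    moreover have "lbar ** Q + lbar ** jq = 0"
      using \<open>Q + jq = 0\<close> by (simp flip: matrix_add_ldistrib)
    ultimately have "lbar ** Q + lq ** jq = lbar ** Q + lbar ** jq" by simp
    then have "(lbar - lq) ** jq = 0" by (simp add: matrix_diff_distrib)
    then show False
      using H_mult_nonzero[OF H_diff[OF quats_in_H(3,1)], of jq] assms(4) \<open>jq \<noteq> 0\<close> by simp
  qed
  then show thesis using that 1 2 3 4 quats_in_H H_mult jq_lq jl by blast
qed

text \<open>This is the inseparable case, where conjugation is trivial on \<open>L\<close> and
  \<open>H\<close> is commutative.\<close>

lemma lbar_eq_lq_iff: "lbar = lq \<longleftrightarrow> (2 :: 'a) = 0 \<and> t = 0"
  unfolding lbar_eq lq_def by (auto simp: quat_simps)

lemma H_commute: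
  assumes "(2 :: 'a) = 0" "t = 0" "M \<in> H t c d" "N \<in> H t c d"
  shows "M ** N = N ** M"
proof -
  obtain x y z w where M: "M = quat t c d x y z w" using assms(3) unfolding H_eq by blast
  obtain x' y' z' w' where N: "N = quat t c d x' y' z' w'" using assms(4) unfolding H_eq by blast
  have "- a = a" for a :: 'a using assms(1) by (metis mult_2 mult_zero_left minus_unique)
  then have sub: "p - q = p + q" for p q :: 'a by (metis diff_conv_add_uminus)
  show ?thesis unfolding M N quat_mult
    by (simp only: assms(2) sub mult_zero_right mult_zero_left add_0_right distrib_left mult.assoc)
      (simp only: ac_simps)
qed

text \<open>In a commutative field of characteristic 2, M^2 - N^2 = (M - N)^2. This makes the
  induced automorphism trivial in the inseparable case.\<close>

lemma H_square_eq:
  assumes "(2 :: 'a) = 0" "t = 0" "M \<in> H t c d" "N \<in> H t c d" "M ** M = N ** N"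
  shows "M = N"
proof (rule ccontr)
  assume "M \<noteq> N"
  have "(M - N) ** (M + N) = 0"
    using H_commute[OF assms(1-4)] assms(5) by (simp add: matrix_add_ldistrib matrix_diff_distrib)
  moreover have "M + N = M - N"
  proof -
    have "- a = a" for a :: 'a using assms(1) by (metis mult_2 mult_zero_left minus_unique)
    then show ?thesis by (simp add: vec_eq_iff diff_conv_add_uminus del: add_uminus_conv_diff)
  qed
  ultimately show False
    using H_mult_nonzero[OF H_diff[OF assms(3,4)], of "M - N"] \<open>M \<noteq> N\<close> by simp
qed

text \<open>Conjugation by \<open>M\<close> transfers the defining relations of \<open>lq\<close>
  and \<open>jq\<close> to \<open>P\<close> and \<open>Q\<close>. If \<open>lbar = lq\<close>, these
  force \<open>P = lq\<close> and \<open>Q = jq\<close>; otherwise the conjugator is built in two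
  stages, as \<open>u ** w\<close>.\<close>

lemma skolem_noether:
  assumes P: "P \<in> H t c d" "M ** lq = P ** M" and Q: "Q \<in> H t c d" "M ** jq = Q ** M"
    and M': "M ** M' = mat 1"
  obtains h where "h \<in> H t c d" "h \<noteq> 0" "h ** lq = P ** h" "h ** jq = Q ** h"
proof -
  have "P ** P ** M = (mscale t P - mscale d (mat 1)) ** M"
  proof -
    have "P ** P ** M = M ** (lq ** lq)" using P(2) by (metis matrix_mul_assoc)
    then show ?thesis using P(2)
      by (simp add: lq_lq matrix_ring_simps)
  qed
  then have PP: "P ** P = mscale t P - mscale d (mat 1)" using cancel_right M' by blast
  have "Q ** Q ** M = mscale (- c) (mat 1) ** M"
  proof -
    have "Q ** Q ** M = M ** (jq ** jq)" using Q(2) by (metis matrix_mul_assoc)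
    then show ?thesis by (simp add: jq_jq matrix_ring_simps)
  qed
  then have QQ: "Q ** Q = mscale (- c) (mat 1)" using cancel_right M' by blast
  have "Q ** P ** M = (mscale t (mat 1) - P) ** Q ** M"
  proof -
    have "Q ** P ** M = M ** (jq ** lq)" using P(2) Q(2) by (metis matrix_mul_assoc)
    also have "\<dots> = (M ** lbar) ** jq" unfolding jq_lq by (rule matrix_mul_assoc)
    also have "M ** lbar = (mscale t (mat 1) - P) ** M"
      unfolding lbar_def using P(2)
      by (simp add: matrix_ring_simps)
    finally show ?thesis using Q(2) by (simp flip: matrix_mul_assoc)
  qed
  then have QP: "Q ** P = (mscale t (mat 1) - P) ** Q" using cancel_right M' by blast
  show thesis
  proof (cases "lbar = lq")
    case True
    then have z: "(2 :: 'a) = 0" "t = 0" by (simp_all add: lbar_eq_lq_iff)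
    have "P = lq" using PP lq_lq z by (intro H_square_eq[OF z P(1) quats_in_H(1)]) simp
    moreover have "Q = jq" using QQ jq_jq z by (intro H_square_eq[OF z Q(1) quats_in_H(2)]) simp
    ultimately show thesis using that[OF quats_in_H(4) mat_1_neq_0] by simp
  next
    case False
    obtain u where u: "u \<in> H t c d" "u \<noteq> 0" "u ** lq = P ** u"
      using conjugate_lq[OF P(1) PP False] by blast
    obtain u' where u': "u' \<in> H t c d" "u ** u' = mat 1" "u' ** u = mat 1"
      using H_inverse[OF u(1,2)] by blast
    \<comment> \<open>Pulling \<open>Q\<close> back along \<open>u\<close> leaves only
      \<open>jq\<close> to be moved, by some \<open>w\<close> that centralizes
      \<open>lq\<close>.\<close>
    define R where "R = u' ** Q ** u"
    have R: "R \<in> H t c d" unfolding R_def by (intro H_mult u u' Q)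
    have RR: "R ** R = mscale (- c) (mat 1)"
    proof -
      have "R ** R = u' ** (Q ** Q) ** u"
        unfolding R_def by (simp add: cancel_left[OF u'(2)] flip: matrix_mul_assoc)
      then show ?thesis using u' by (simp add: QQ matrix_ring_simps)
    qed
    have uP: "u' ** P = lq ** u'"
      using u(3) u'(2,3) by (metis matrix_mul_assoc matrix_mul_lid matrix_mul_rid)
    have "R ** lq = u' ** (Q ** P) ** u"
      unfolding R_def using u(3) by (simp flip: matrix_mul_assoc)
    also have "\<dots> = (u' ** (mscale t (mat 1) - P)) ** (Q ** u)"
      unfolding QP by (simp add: matrix_mul_assoc)
    also have "u' ** (mscale t (mat 1) - P) = lbar ** u'"
      unfolding lbar_def using uP
      by (simp add: matrix_ring_simps)
    finally have Rl: "R ** lq = lbar ** R" unfolding R_def by (simp add: matrix_mul_assoc)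
    obtain w where w: "w \<in> H t c d" "w \<noteq> 0" "w ** jq = R ** w" "w ** lq = lq ** w"
      using conjugate_jq[OF R RR Rl False] by blast
    have "u ** R = Q ** u"
      unfolding R_def by (simp add: cancel_left[OF u'(2)] flip: matrix_mul_assoc)
    then have "u ** w ** lq = P ** (u ** w)" "u ** w ** jq = Q ** (u ** w)"
      using u(3) w(3,4) by (metis matrix_mul_assoc)+
    then show thesis using that[OF H_mult[OF u(1) w(1)] H_mult_nonzero[OF u(1,2) w(2)]] by blast
  qed
qed

section \<open>The two inclusions for the stabilizer\<close>

lemma stabilizer_subset:
  assumes M: "M \<in> stabilizer (W t c d)"
  shows "\<exists>h n. M = h ** n \<and> h \<in> H_units t c d \<and> n \<in> H_rho t c d"
proof -
  obtain M' where M': "M ** M' = mat 1"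
    using M unfolding stabilizer_def GL4_def invertible_def by blast
  obtain P Q where P: "P \<in> H t c d" "M ** lq = P ** M" and Q: "Q \<in> H t c d" "M ** jq = Q ** M"
    using stabilizer_normalizes_H[OF M] by blast
  obtain h where h: "h \<in> H t c d" "h \<noteq> 0" "h ** lq = P ** h" "h ** jq = Q ** h"
    using skolem_noether[OF P Q M'] by blast
  obtain h' where h': "h ** h' = mat 1" "h' ** h = mat 1" using H_inverse[OF h(1,2)] by blast
  \<comment> \<open>\<open>h\<close> and \<open>M\<close> induce the same conjugation on the
    generators, so \<open>n\<close> centralizes them.\<close>
  define n where "n = h' ** M"
  have hn: "M = h ** n" unfolding n_def by (simp add: cancel_left[OF h'(1)])
  have "h' ** P = lq ** h'" "h' ** Q = jq ** h'"
    using h(3,4) h' by (metis matrix_mul_assoc matrix_mul_lid matrix_mul_rid)+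
  then have "n ** lq = lq ** n" "n ** jq = jq ** n"
    unfolding n_def using P(2) Q(2) by (metis matrix_mul_assoc)+
  then obtain x y z w where n: "n = quat_rho t c d x y z w" using centralizer by blast
  have "n \<noteq> 0" using M' mat_1_neq_0 unfolding hn by (auto simp: matrix_zero)
  then have "(x, y, z, w) \<noteq> (0, 0, 0, 0)" unfolding n by (auto simp: quat_simps)
  then have "n \<in> H_rho t c d" unfolding H_rho_eq n by blast
  then show ?thesis using hn h unfolding H_units_def by blast
qed

lemma H_units_stabilizer: "M \<in> H_units t c d \<Longrightarrow> M \<in> stabilizer (W t c d)"
  using H_inverse[of M] stabilizer_I[of M] H_act unfolding H_units_def by (metis Diff_iff singletonI)

lemma mscale_W: "X \<in> W t c d \<Longrightarrow> mscale k X \<in> W t c d"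
  unfolding W_def by (rule mat4.span_scale)

lemma H_rho_stabilizer:
  assumes "N \<in> H_rho t c d"
  shows "N \<in> stabilizer (W t c d)"
proof -
  obtain x y z w where N: "N = quat_rho t c d x y z w" and nz: "(x, y, z, w) \<noteq> (0, 0, 0, 0)"
    using assms unfolding H_rho_eq by blast
  define n where "n = nrm x y z w"
  have n: "n \<noteq> 0" using nz nrm_eq_0[of x y z w] unfolding n_def by blast
  define C where "C = quat_rho t c d (x + y * t) (- y) (- z) (- w)"
  have NC: "N ** mscale (inverse n) C = mat 1" "mscale (inverse n) C ** N = mat 1"
    using n quat_rho_mult_conj[of x y z w] quat_rho_conj_mult[of x y z w]
    by (simp_all add: N C_def n_def mscale_mult_left mscale_mult_right mat4.scale_scale)
  \<comment> \<open>The inverse again has the form \<open>quat_rho\<close>, so it too acts on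
    \<open>W\<close> by a scalar.\<close>
  have scal: "mscale (inverse n) C = quat_rho t c d (inverse n * (x + y * t)) (inverse n * (- y))
      (inverse n * (- z)) (inverse n * (- w))"
    unfolding C_def by (simp add: quat_simps algebra_simps)
  show ?thesis
    by (rule stabilizer_I[OF NC]) (simp_all add: H_rho_act[OF N] H_rho_act[OF scal] mscale_W)
qed

end

theorem theorem6p6:
  fixes c d t :: "'a::field"
  assumes "2 * t = 0"
    and "anisotropic_on pf (W t c d)"
  shows "stabilizer (W t c d) = {M ** N | M N. M \<in> H_units t c d \<and> N \<in> H_rho t c d}"
proof -
  interpret anisotropic_W c d t using assms by unfold_locales
  show ?thesis
  proof (intro equalityI subsetI)
    fix M assume "M \<in> stabilizer (W t c d)"
    then show "M \<in> {M ** N | M N. M \<in> H_units t c d \<and> N \<in> H_rho t c d}"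
      using stabilizer_subset by blast
  next
    fix M assume "M \<in> {M ** N | M N. M \<in> H_units t c d \<and> N \<in> H_rho t c d}"
    then show "M \<in> stabilizer (W t c d)"
      using stabilizer_mult H_units_stabilizer H_rho_stabilizer by blast
  qed
qed

end
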